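(* Let $p$ be an odd prime, $n\ge0$ an integer, and $x$ a monic monomial in $A^\vee(n)$. The directed graph $G_x^{\mathrm{dir}}$ is unilateral if and only if (1) for each $\xi_i^{p^j}\in A^\vee(n)$ (i.e. for all $i\ge1$, $j\ge0$ with $i+j\le n$), at least one summand of $c(\xi_i^{p^j})$ is a factor of $x$, (2) and $\tau_0$ is a factor of $x$.
   Context: $A^\vee(n)=\mathbb{F}_p[\xi_1,\dots,\xi_n,\tau_0,\dots,\tau_n]/(\xi_1^{p^n},\xi_2^{p^{n-1}},\dots,\xi_n^{p},\tau_0^2,\dots,\tau_n^2)$ (the $\tau_i$ are exterior generators) is a quotient Hopf algebra of the mod $p$ dual Steenrod algebra. A monic monomial in $A^\vee(n)$ is an element $x=\tau_0^{\epsilon_0}\cdots\tau_n^{\epsilon_n}\xi_1^{r_1}\cdots\xi_n^{r_n}$ with $\epsilon_i\in\{0,1\}$ and $0\le r_i\le p^{n+1-i}-1$. Write the base-$p$ expansion $r_i=\sum_{j=0}^{n-i}c_{i,j}p^j$ with $0\le c_{i,j}\le p-1$. "Factor" means divisor as a monomial (exponentwise), ignoring signs. The antipode $c:A^\vee(n)\to A^\vee(n)$ is the algebra map which on the $\xi$'s is determined by $c(\xi_m)=-\xi_m-\sum_{k=1}^{m-1}\xi_{m-k}^{p^k}c(\xi_k)$ for $m\ge1$. The summands of $c(\xi_i^{p^j})=c(\xi_i)^{p^j}$ are the signed monomials occurring when it is expanded in the monomial basis of $A^\vee(n)$. The graph $G_x$ is the undirected multigraph with vertex set $\{1,2p^0,2p^1,\dots,2p^n\}$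 having: one edge (labelled $\tau_i$) between $1$ and $2p^i$ for each $i$ with $\epsilon_i=1$; exactly $c_{i,j}$ edges (labelled $\xi_i^{p^j}$) between $2p^j$ and $2p^{i+j}$ for all $1\le i\le n$, $0\le j\le n-i$; and no other edges. $G_x^{\mathrm{dir}}$ is $G_x$ with every edge oriented towards its larger end. A directed graph is unilateral if for every pair of distinct vertices $v,w$ there is a directed path from $v$ to $w$ or from $w$ to $v$.
   Formalization: "Factor" is taken digitwise: the base-p digits of each ξ_i-exponent of the summand must be at most those of x. With plain exponentwise divisibility the "if" direction fails, e.g. p=3, n=2, x=τ_0ξ_1^3ξ_2. *)

theory Defs
  imports
    "HOL-Library.Poly_Mapping"
    "HOL-Algebra.Ring"
    "Berlekamp_Zassenhaus.Finite_Field"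
    "Graph_Theory.Arc_Walk"
begin

section \<open>The algebra \<open>A\<^sup>\<or>(n)\<close>\<close>

text \<open>
  \<open>Monomial \<epsilon> r\<close> stands for \<open>\<tau>\<^sub>0^\<epsilon> 0 \<cdots> \<tau>\<^sub>n^\<epsilon> n * \<xi>\<^sub>1^r 1 \<cdots> \<xi>\<^sub>n^r n\<close>, in this order; \<open>\<xi>\<^sub>0\<close> is not a
  generator, so the value at \<open>0\<close> of the second function has to be \<open>0\<close> in a monomial.
\<close>

datatype monomial = Monomial (tau_exp: "nat \<Rightarrow> nat") (xi_exp: "nat \<Rightarrow> nat")

definition monomials :: "nat \<Rightarrow> nat \<Rightarrow> monomial set" where
  "monomials p n = {m.
     (\<forall>i\<le>n. tau_exp m i \<in> {0, 1}) \<and> (\<forall>i>n. tau_exp m i = 0) \<and>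
     (\<forall>i\<in>{1..n}. xi_exp m i \<le> p ^ (n + 1 - i) - 1) \<and> (\<forall>i. i \<notin> {1..n} \<longrightarrow> xi_exp m i = 0)}"

definition mono_one :: monomial where
  "mono_one = Monomial (\<lambda>_. 0) (\<lambda>_. 0)"

definition mono_tau :: "nat \<Rightarrow> monomial" where
  "mono_tau i = Monomial (\<lambda>k. if k = i then 1 else 0) (\<lambda>_. 0)"

definition mono_xi :: "nat \<Rightarrow> monomial" where
  "mono_xi i = Monomial (\<lambda>_. 0) (\<lambda>k. if k = i then 1 else 0)"

definition mono_times :: "monomial \<Rightarrow> monomial \<Rightarrow> monomial" where
  "mono_times a b = Monomial (\<lambda>i. tau_exp a i + tau_exp b i) (\<lambda>i. xi_exp a i + xi_exp b i)"

text \<open>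
  The number of transpositions of odd generators \<open>\<tau>\<^sub>i \<tau>\<^sub>j = - \<tau>\<^sub>j \<tau>\<^sub>i\<close> (\<open>j < i\<close>) needed to sort the
  product of the monomials \<open>a\<close> and \<open>b\<close>; the \<open>\<xi>\<^sub>i\<close> are even and central.
\<close>

definition tau_inversions :: "monomial \<Rightarrow> monomial \<Rightarrow> nat" where
  "tau_inversions a b = card {(i, j). j < i \<and> tau_exp a i = 1 \<and> tau_exp b j = 1}"

text \<open>
  The ideal of relations is generated by the monomials \<open>\<xi>\<^sub>i^(p^(n+1-i))\<close> (together with
  \<open>\<tau>\<^sub>i\<^sup>2 = 0\<close>), so the quotient is the vector space over the field with \<open>p\<close> elements with basis
  \<open>monomials p n\<close>, in which a product of basis monomials is, up to sign, the product monomial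
  if that is again in the basis, and \<open>0\<close> otherwise. The prime \<open>p\<close> is \<open>CARD('p)\<close>.
\<close>

type_synonym 'p dual_elem = "monomial \<Rightarrow>\<^sub>0 'p mod_ring"

definition dual_times :: "nat \<Rightarrow> 'p::prime_card dual_elem \<Rightarrow> 'p dual_elem \<Rightarrow> 'p dual_elem" where
  "dual_times n f g = (\<Sum>a\<in>Poly_Mapping.keys f. \<Sum>b\<in>Poly_Mapping.keys g.
     if mono_times a b \<in> monomials CARD('p) n
     then Poly_Mapping.single (mono_times a b)
            ((- 1) ^ tau_inversions a b * Poly_Mapping.lookup f a * Poly_Mapping.lookup g b)
     else 0)"

definition dual_A :: "nat \<Rightarrow> 'p::prime_card dual_elem ring" where
  "dual_A n =
    \<lparr>carrier = {f. Poly_Mapping.keys f \<subseteq> monomials CARD('p) n},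
     monoid.mult = dual_times n,
     one = Poly_Mapping.single mono_one 1,
     zero = 0,
     add = (+)\<rparr>"

definition tau :: "nat \<Rightarrow> 'p::prime_card dual_elem" where
  "tau i = Poly_Mapping.single (mono_tau i) 1"

definition xi :: "nat \<Rightarrow> 'p::prime_card dual_elem" where
  "xi i = Poly_Mapping.single (mono_xi i) 1"

section \<open>The antipode\<close>

fun antipode_xi :: "nat \<Rightarrow> nat \<Rightarrow> 'p::prime_card dual_elem" where
  "antipode_xi n m = - xi m -
     (\<Sum>k\<in>{1..<m}. (xi (m - k) [^]\<^bsub>dual_A n\<^esub> (CARD('p) ^ k)) \<otimes>\<^bsub>dual_A n\<^esub> antipode_xi n k)"

text \<open>
  Milnor's recursion on the exterior generators. The summand with index \<open>k\<close> has the factor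
  \<open>\<xi>\<^bsub>m-k\<^esub>\<close> with \<open>m - k \<ge> 1\<close>; the one with \<open>k = m\<close> has been moved to the left-hand side.
\<close>

fun antipode_tau :: "nat \<Rightarrow> nat \<Rightarrow> 'p::prime_card dual_elem" where
  "antipode_tau n m = - tau m -
     (\<Sum>k\<in>{0..<m}. (xi (m - k) [^]\<^bsub>dual_A n\<^esub> (CARD('p) ^ k)) \<otimes>\<^bsub>dual_A n\<^esub> antipode_tau n k)"

declare antipode_xi.simps [simp del] antipode_tau.simps [simp del]

definition antipode_mono :: "nat \<Rightarrow> monomial \<Rightarrow> 'p::prime_card dual_elem" where
  "antipode_mono n m = foldr (\<lambda>f g. f \<otimes>\<^bsub>dual_A n\<^esub> g)
     (map (\<lambda>i. antipode_tau n i [^]\<^bsub>dual_A n\<^esub> tau_exp m i) [0..<n + 1] @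
      map (\<lambda>i. antipode_xi n i [^]\<^bsub>dual_A n\<^esub> xi_exp m i) [1..<n + 1])
     \<one>\<^bsub>dual_A n\<^esub>"

text \<open>
  The algebra map with the prescribed values on the generators. As \<open>A\<^sup>\<or>(n)\<close> is graded
  commutative, the antipode is multiplicative and not only anti-multiplicative.
\<close>

definition antipode :: "nat \<Rightarrow> 'p::prime_card dual_elem \<Rightarrow> 'p dual_elem" where
  "antipode n f = (\<Sum>m\<in>Poly_Mapping.keys f.
     Poly_Mapping.single mono_one (Poly_Mapping.lookup f m) \<otimes>\<^bsub>dual_A n\<^esub> antipode_mono n m)"

text \<open>The monomials, without their signs, that occur in the expansion of an element.\<close>

definition summands :: "'p::prime_card dual_elem \<Rightarrow> monomial set" where
  "summands f = Poly_Mapping.keys f"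

section \<open>Factors of monomials\<close>

text \<open>\<open>base_digit p r j\<close> is the coefficient of \<open>p^j\<close> in the base-\<open>p\<close> expansion of \<open>r\<close>.\<close>

definition base_digit :: "nat \<Rightarrow> nat \<Rightarrow> nat \<Rightarrow> nat" where
  "base_digit p r j = r div p ^ j mod p"

text \<open>
  Factors are taken exponentwise with respect to the factorization of a monomial into the
  generators \<open>\<tau>\<^sub>i\<close> and \<open>\<xi>\<^sub>i^(p^j)\<close> that label the edges of the graph below: the exponent of
  \<open>\<xi>\<^sub>i^(p^j)\<close> is the base-\<open>p\<close> digit \<open>c\<^bsub>i,j\<^esub>\<close> of \<open>r\<^sub>i\<close>. In particular \<open>\<xi>\<^sub>1\<close> is not a factor of
  \<open>\<xi>\<^sub>1^p\<close>. With the coarser relation that compares the \<open>r\<^sub>i\<close> themselves the characterization of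
  unilateral graphs fails: for \<open>n = 2\<close> and \<open>x = \<tau>\<^sub>0 \<xi>\<^sub>1^p \<xi>\<^sub>2\<close> the monomials \<open>\<xi>\<^sub>1\<close>, \<open>\<xi>\<^sub>1^p\<close>, \<open>\<xi>\<^sub>2\<close> and
  \<open>\<tau>\<^sub>0\<close> would all be factors of \<open>x\<close>, but the only edges of the graph are \<open>1 \<rightarrow> 2\<close>,
  \<open>2 \<rightarrow> 2p\<^sup>2\<close> and \<open>2p \<rightarrow> 2p\<^sup>2\<close>, and no directed path joins \<open>2\<close> and \<open>2p\<close>.
\<close>

definition is_factor :: "nat \<Rightarrow> monomial \<Rightarrow> monomial \<Rightarrow> bool" where
  "is_factor p s x \<longleftrightarrow>
     (\<forall>i. tau_exp s i \<le> tau_exp x i) \<and>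
     (\<forall>i j. base_digit p (xi_exp s i) j \<le> base_digit p (xi_exp x i) j)"

section \<open>The graph of a monomial\<close>

record ('v, 'e) multigraph =
  vertices :: "'v set"
  edges :: "'e set"
  ends :: "'e \<Rightarrow> 'v set"

text \<open>
  \<open>Tau_Edge i\<close> is the edge labelled \<open>\<tau>\<^sub>i\<close>; \<open>Xi_Edge i j k\<close> is the edge number \<open>k\<close> (counted from \<open>0\<close>)
  among the parallel edges labelled \<open>\<xi>\<^sub>i^(p^j)\<close>.
\<close>

datatype edge = Tau_Edge nat | Xi_Edge nat nat nat

primrec edge_ends :: "nat \<Rightarrow> edge \<Rightarrow> nat set" where
  "edge_ends p (Tau_Edge i) = {1, 2 * p ^ i}"
| "edge_ends p (Xi_Edge i j k) = {2 * p ^ j, 2 * p ^ (i + j)}"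

definition graph_of :: "nat \<Rightarrow> nat \<Rightarrow> monomial \<Rightarrow> (nat, edge) multigraph" where
  "graph_of p n x =
    \<lparr>vertices = insert 1 {2 * p ^ j | j. j \<le> n},
     edges = {Tau_Edge i | i. i \<le> n \<and> tau_exp x i = 1} \<union>
       {Xi_Edge i j k | i j k. 1 \<le> i \<and> i + j \<le> n \<and> k < base_digit p (xi_exp x i) j},
     ends = edge_ends p\<rparr>"

definition orient_to_larger :: "('v::linorder, 'e) multigraph \<Rightarrow> ('v, 'e) pre_digraph" where
  "orient_to_larger G =
    \<lparr>verts = vertices G, arcs = edges G,
     tail = (\<lambda>e. Min (ends G e)), head = (\<lambda>e. Max (ends G e))\<rparr>"

definition unilateral :: "('v, 'e) pre_digraph \<Rightarrow> bool" where
  "unilateral G \<longleftrightarrow> (\<forall>v\<in>verts G. \<forall>w\<in>verts G. v \<noteq> w \<longrightarrow>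
     (\<exists>q. pre_digraph.apath G v q w) \<or> (\<exists>q. pre_digraph.apath G w q v))"

end

theory Submission
  imports Defs "HOL-Computational_Algebra.Formal_Power_Series"
begin

text \<open>
  All arcs increase along the totally ordered vertices, so the graph is unilateral iff any two
  consecutive vertices are joined by an arc. These arcs are labelled \<open>\<tau>\<^sub>0\<close> and \<open>\<xi>\<^sub>1^(p^j)\<close>, so
  unilaterality means that \<open>\<tau>\<^sub>0\<close> and every \<open>\<xi>\<^sub>1^(p^j)\<close> with \<open>j < n\<close> divide \<open>x\<close>. The conditions on the
  antipode imply this since \<open>c(\<xi>\<^sub>1^(p^j))\<close> is \<open>\<xi>\<^sub>1^(p^j)\<close> up to sign. Conversely, setting the \<open>\<xi>\<^sub>k\<close> with
  \<open>k > 1\<close> to \<open>0\<close> leaves a single term of the recursion for \<open>c(\<xi>\<^sub>i)\<close>, so that \<open>c(\<xi>\<^sub>i)^(p^j)\<close>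
  contains \<open>\<xi>\<^sub>1^(p^j + \<dots> + p^(i+j-1))\<close> up to sign, and this product of the \<open>\<xi>\<^sub>1^(p^k)\<close> divides \<open>x\<close>.
\<close>

section \<open>Unilateral graphs with increasing arcs\<close>

text \<open>Walks never descend, so a walk between consecutive vertices must go upwards and has no
  vertex to stop at in between; conversely, arcs between neighbours chain together to paths between
  any two vertices.\<close>

lemma unilateral_increasing_iff:
  fixes G :: "('v::linorder, 'e) pre_digraph"
  assumes f: "strict_mono f" and verts: "verts G = f ` {..m}"
    and arcs: "\<And>e. e \<in> arcs G \<Longrightarrow> tail G e \<in> verts G \<and> head G e \<in> verts G \<and> tail G e < head G e"
  shows "unilateral G \<longleftrightarrow> (\<forall>k<m. \<exists>e\<in>arcs G. tail G e = f k \<and> head G e = f (Suc k))"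
proof -
  interpret wf_digraph G
    by unfold_locales (use arcs in auto)
  have mono: "u \<le> v" if "awalk u q v" for u q v
    using that
  proof (induction q arbitrary: u)
    case (Cons e q)
    then have "e \<in> arcs G" "tail G e = u" "head G e \<le> v"
      by (auto simp: awalk_Cons_iff)
    with arcs[of e] show ?case by auto
  qed (simp add: awalk_Nil_iff)
  show ?thesis
  proof (intro iffI allI impI)
    fix k assume un: "unilateral G" and k: "k < m"
    have lt: "f k < f (Suc k)"
      using f by (simp add: strict_mono_less)
    have "f k \<in> verts G" "f (Suc k) \<in> verts G"
      using k by (auto simp: verts)
    \<comment> \<open>Unilaterality leaves the direction open; \<open>mono\<close> then excludes a
      walk from the larger to the smaller vertex.\<close>
    with un lt obtain q where "apath (f k) q (f (Suc k)) \<or> apath (f (Suc k)) q (f k)"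
      unfolding unilateral_def by (metis less_irrefl)
    with mono lt have w: "awalk (f k) q (f (Suc k))"
      by (meson awalkI_apath leD)
    then obtain e q' where q: "q = e # q'"
      using lt by (cases q) (auto simp: awalk_Nil_iff)
    with w have e: "e \<in> arcs G" "tail G e = f k" and w': "awalk (head G e) q' (f (Suc k))"
      by (auto simp: awalk_Cons_iff)
    obtain j where j: "head G e = f j"
      using arcs[OF e(1)] by (auto simp: verts)
    \<comment> \<open>The first arc strictly ascends and the rest of the walk does not descend,
      which squeezes its head between consecutive values of \<open>f\<close>.\<close>
    have "f k < f j" "f j \<le> f (Suc k)"
      using arcs[OF e(1)] e j mono[OF w'] by auto
    with f have "j = Suc k"
      by (simp add: strict_mono_less strict_mono_less_eq)
    with e j show "\<exists>e\<in>arcs G. tail G e = f k \<and> head G e = f (Suc k)"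
      by auto
  next
    assume gen: "\<forall>k<m. \<exists>e\<in>arcs G. tail G e = f k \<and> head G e = f (Suc k)"
    have path: "\<exists>q. apath (f i) q (f j)" if "i \<le> j" "j \<le> m" for i j
    proof -
      from that(1) have "f i \<rightarrow>\<^sup>*\<^bsub>G\<^esub> f j"
      proof (induction rule: inc_induct)
        case base
        show ?case
          using \<open>j \<le> m\<close> by (simp add: verts)
      next
        case (step i)
        then obtain e where "e \<in> arcs G" "tail G e = f i" "head G e = f (Suc i)"
          using \<open>j \<le> m\<close> gen by (meson less_le_trans)
        then have "f i \<rightarrow>\<^bsub>G\<^esub> f (Suc i)"
          by (metis in_arcs_imp_in_arcs_ends)
        with step.IH show ?case
          by (meson adj_reachable_trans)
      qed
      \<comment> \<open>Reachability supplies a walk without repeated vertices, as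
        \<open>apath\<close> demands.\<close>
      then show ?thesis
        by (simp add: reachable_apath)
    qed
    show "unilateral G"
      unfolding unilateral_def
    proof (intro ballI impI)
      fix v w assume "v \<in> verts G" "w \<in> verts G"
      then obtain i j where "v = f i" "w = f j" "i \<le> m" "j \<le> m"
        by (auto simp: verts)
      then show "(\<exists>q. apath v q w) \<or> (\<exists>q. apath w q v)"
        using path by (metis nat_le_linear)
    qed
  qed
qed

text \<open>An edge labelled \<open>\<xi>\<^sub>i^(p^j)\<close> climbs \<open>i\<close> places in
  the order of the vertices, and \<open>\<tau>\<^sub>i\<close> climbs \<open>i + 1\<close> places
  from the bottom. Neighbours are therefore joined only by \<open>\<tau>\<^sub>0\<close> and by the
  edges with \<open>i = 1\<close>.\<close>

lemma unilateral_graph_of_iff: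
  assumes "2 \<le> p"
  shows "unilateral (orient_to_larger (graph_of p n x)) \<longleftrightarrow>
    tau_exp x 0 = 1 \<and> (\<forall>j<n. 1 \<le> base_digit p (xi_exp x 1) j)"
proof -
  define G where "G = orient_to_larger (graph_of p n x)"
  \<comment> \<open>Position 0 is taken by the vertex 1, so \<open>2 * p ^ j\<close> stands at
    position \<open>Suc j\<close>.\<close>
  define f where "f = case_nat 1 (\<lambda>j. 2 * p ^ j)"
  have f_simps: "f 0 = 1" "f (Suc j) = 2 * p ^ j" for j
    by (simp_all add: f_def)
  have f: "strict_mono f"
  proof (rule strict_mono_Suc_iff[THEN iffD2], rule allI)
    fix k show "f k < f (Suc k)"
      using assms by (cases k) (auto simp: f_simps)
  qed
  have arcs_G: "arcs G = {Tau_Edge i | i. i \<le> n \<and> tau_exp x i = 1} \<union>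
      {Xi_Edge i j k | i j k. 1 \<le> i \<and> i + j \<le> n \<and> k < base_digit p (xi_exp x i) j}"
    by (simp add: G_def orient_to_larger_def graph_of_def)
  have verts_G: "verts G = f ` {..Suc n}"
    by (auto simp: G_def orient_to_larger_def graph_of_def f_simps atMost_Suc_eq_insert_0 image_iff)
  have tau_ends: "tail G (Tau_Edge i) = f 0" "head G (Tau_Edge i) = f (Suc i)" for i
    using assms
    by (auto simp: G_def orient_to_larger_def graph_of_def f_simps min_def max_def)
  have xi_ends: "tail G (Xi_Edge i j k) = f (Suc j)" "head G (Xi_Edge i j k) = f (Suc (i + j))" for i j k
    using assms
    by (auto simp: G_def orient_to_larger_def graph_of_def f_simps min_def max_def power_add)
  have inj: "f i = f j \<longleftrightarrow> i = j" for i j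
    using f by (simp add: strict_mono_eq)
  have "unilateral G \<longleftrightarrow> (\<forall>k<Suc n. \<exists>e\<in>arcs G. tail G e = f k \<and> head G e = f (Suc k))"
  proof (rule unilateral_increasing_iff[OF f verts_G])
    fix e assume "e \<in> arcs G"
    then show "tail G e \<in> verts G \<and> head G e \<in> verts G \<and> tail G e < head G e"
      using f by (cases e) (auto simp: arcs_G verts_G tau_ends xi_ends strict_mono_less)
  qed
  also have "\<dots> \<longleftrightarrow> (\<exists>e\<in>arcs G. tail G e = f 0 \<and> head G e = f (Suc 0)) \<and>
      (\<forall>j<n. \<exists>e\<in>arcs G. tail G e = f (Suc j) \<and> head G e = f (Suc (Suc j)))"
    by (auto simp: less_Suc_eq_0_disj)
  also have "(\<exists>e\<in>arcs G. tail G e = f 0 \<and> head G e = f (Suc 0)) \<longleftrightarrow> tau_exp x 0 = 1"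
    (is "?L \<longleftrightarrow> ?R")
  proof
    assume ?L
    then show ?R
      by (auto simp: arcs_G tau_ends xi_ends inj)
  next
    assume ?R
    then have "Tau_Edge 0 \<in> arcs G"
      by (auto simp: arcs_G)
    then show ?L
      by (rule bexI[rotated]) (simp add: tau_ends)
  qed
  also have "(\<exists>e\<in>arcs G. tail G e = f (Suc j) \<and> head G e = f (Suc (Suc j))) \<longleftrightarrow>
      1 \<le> base_digit p (xi_exp x 1) j" if "j < n" for j
  proof
    assume "\<exists>e\<in>arcs G. tail G e = f (Suc j) \<and> head G e = f (Suc (Suc j))"
    then show "1 \<le> base_digit p (xi_exp x 1) j"
      by (auto simp: arcs_G tau_ends xi_ends inj)
  next
    assume "1 \<le> base_digit p (xi_exp x 1) j"
    with that have "Xi_Edge 1 j 0 \<in> arcs G"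
      by (auto simp: arcs_G)
    then show "\<exists>e\<in>arcs G. tail G e = f (Suc j) \<and> head G e = f (Suc (Suc j))"
      by (rule bexI[rotated]) (simp add: xi_ends)
  qed
  then have "(\<forall>j<n. \<exists>e\<in>arcs G. tail G e = f (Suc j) \<and> head G e = f (Suc (Suc j))) \<longleftrightarrow>
      (\<forall>j<n. 1 \<le> base_digit p (xi_exp x 1) j)"
    by blast
  finally show ?thesis
    by (simp add: G_def)
qed

section \<open>Base-\<open>p\<close> digits\<close>

lemma base_digit_0: "base_digit p r 0 = r mod p"
  by (simp add: base_digit_def)

lemma base_digit_Suc: "base_digit p r (Suc j) = base_digit p (r div p) j"
  by (simp add: base_digit_def div_mult2_eq)

text \<open>Induction on the digit: modulo \<open>p\<close> only the exponent 0 contributes, and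
  division by \<open>p\<close> shifts the interval of exponents down by one.\<close>

lemma base_digit_sum_powers:
  assumes "2 \<le> p"
  shows "base_digit p (\<Sum>k = a..<b. p ^ k) j = (if a \<le> j \<and> j < b then 1 else 0)"
proof (induction j arbitrary: a b)
  case 0
  have "(\<Sum>k = a..<b. p ^ k) mod p = (\<Sum>k = a..<b. p ^ k mod p) mod p"
    by (simp add: mod_sum_eq)
  also have "(\<Sum>k = a..<b. p ^ k mod p) = (\<Sum>k = a..<b. if k = 0 then 1 else 0)"
    using assms by (intro sum.cong) (auto simp: power_0_left gr0_conv_Suc)
  finally show ?case
    using assms by (auto simp: base_digit_0)
next
  case (Suc j)
  \<comment> \<open>Truncated subtraction is right at the boundary: for \<open>a = 0 < b\<close> the
    lost summand \<open>p ^ 0\<close> is the remainder, so the lower end stays at 0.\<close>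
  have "(\<Sum>k = a..<b. p ^ k) div p = (\<Sum>k = a - 1..<b - 1. p ^ k)"
  proof (cases a)
    case 0
    show ?thesis
    proof (cases b)
      case (Suc b')
      have "(\<Sum>k = a..<b. p ^ k) = 1 + p * (\<Sum>k = 0..<b'. p ^ k)"
        unfolding 0 Suc by (subst sum.atLeast0_lessThan_Suc_shift) (simp add: sum_distrib_left)
      moreover have "(1 + p * s) div p = s" for s
        using assms by (intro div_nat_eqI) auto
      ultimately show ?thesis
        using 0 Suc by simp
    qed (simp add: 0)
  next
    case (Suc a')
    have "(\<Sum>k = a..<b. p ^ k) = p * (\<Sum>k = a'..<b - 1. p ^ k)"
    proof (cases b)
      case (Suc b')
      show ?thesis
        unfolding Suc \<open>a = Suc a'\<close> by (subst sum.shift_bounds_Suc_ivl) (simp add: sum_distrib_left)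
    qed simp
    with Suc assms show ?thesis by simp
  qed
  then show ?case
    by (auto simp: base_digit_Suc Suc.IH)
qed

lemma base_digit_power:
  assumes "2 \<le> p"
  shows "base_digit p (p ^ k) j = (if j = k then 1 else 0)"
  using base_digit_sum_powers[OF assms, of k "Suc k" j] by auto

section \<open>The algebra \<open>A\<^sup>\<or>(n)\<close>\<close>

definition xi_power :: "nat \<Rightarrow> nat \<Rightarrow> monomial" where
  "xi_power i r = Monomial (\<lambda>_. 0) (\<lambda>k. if k = i then r else 0)"

lemma xi_power_0: "xi_power i 0 = mono_one"
  by (simp add: xi_power_def mono_one_def)

lemma xi_power_1: "xi_power i (Suc 0) = mono_xi i"
  by (simp add: xi_power_def mono_xi_def fun_eq_iff)

lemma xi_power_eq_iff [simp]: "xi_power i r = xi_power i s \<longleftrightarrow> r = s"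
  by (auto simp: xi_power_def fun_eq_iff)

lemma tau_exp_xi_power [simp]: "tau_exp (xi_power i r) k = 0"
  by (simp add: xi_power_def)

lemma xi_exp_xi_power [simp]: "xi_exp (xi_power i r) k = (if k = i then r else 0)"
  by (simp add: xi_power_def)

text \<open>Exponents are natural numbers and cannot cancel, so every factor of a power of one
  generator is again such a power. This is why the coefficients at these powers multiply like those
  of power series.\<close>

lemma mono_times_eq_xi_power_iff:
  "mono_times a b = xi_power i r \<longleftrightarrow> (\<exists>s\<le>r. a = xi_power i s \<and> b = xi_power i (r - s))"
proof
  assume eq: "mono_times a b = xi_power i r"
  then have t: "tau_exp a k = 0" "tau_exp b k = 0"
    and x: "xi_exp a k + xi_exp b k = (if k = i then r else 0)" for k
    by (auto simp: mono_times_def xi_power_def fun_eq_iff)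
  have "xi_exp a i \<le> r" "xi_exp b i = r - xi_exp a i"
    using x[of i] by auto
  moreover have "a = xi_power i (xi_exp a i)" "b = xi_power i (xi_exp b i)"
    using t x by (auto simp: xi_power_def fun_eq_iff intro!: monomial.expand)
      (metis add_is_0)+
  ultimately show "\<exists>s\<le>r. a = xi_power i s \<and> b = xi_power i (r - s)"
    by metis
qed (auto simp: mono_times_def xi_power_def fun_eq_iff)

text \<open>The exponent 0 is a separate case because \<open>xi_power i 0\<close> is the unit
  monomial even when \<open>i\<close> is not the index of a generator.\<close>

lemma xi_power_in_monomials_iff:
  assumes "2 \<le> p"
  shows "xi_power i r \<in> monomials p n \<longleftrightarrow> r = 0 \<or> (1 \<le> i \<and> i \<le> n \<and> r < p ^ (n + 1 - i))"
  using assms by (auto simp: monomials_def xi_power_def le_less_Suc_eq less_eq_Suc_le le_diff_conv2)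

lemma mono_times_one [simp]: "mono_times mono_one a = a" "mono_times a mono_one = a"
  by (simp_all add: mono_times_def mono_one_def)

lemma tau_inversions_mono_one [simp]:
  "tau_inversions mono_one a = 0" "tau_inversions a mono_one = 0"
  by (simp_all add: tau_inversions_def mono_one_def)

lemma tau_inversions_xi_power [simp]: "tau_inversions (xi_power i r) a = 0"
  by (simp add: tau_inversions_def)

section \<open>Unit, powers and closure for the truncated product\<close>

lemma two_le_prime_card: "2 \<le> CARD('p::prime_card)"
  using prime_card[where 'a = 'p] by (rule prime_ge_2_nat)

lemma dual_A_simps [simp]:
  "carrier (dual_A n :: 'p::prime_card dual_elem ring) =
    {f. Poly_Mapping.keys f \<subseteq> monomials CARD('p) n}"
  "monoid.mult (dual_A n) = dual_times n"
  "one (dual_A n) = Poly_Mapping.single mono_one 1"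
  by (simp_all add: dual_A_def)

lemma dual_pow_0: "f [^]\<^bsub>dual_A n\<^esub> (0::nat) = Poly_Mapping.single mono_one 1"
  by (simp add: nat_pow_def)

lemma dual_pow_Suc: "f [^]\<^bsub>dual_A n\<^esub> Suc k = dual_times n (f [^]\<^bsub>dual_A n\<^esub> k) f"
  by (simp add: nat_pow_def)

lemma sum_single_lookup: "(\<Sum>m\<in>Poly_Mapping.keys f. Poly_Mapping.single m (Poly_Mapping.lookup f m)) = f"
  by (rule poly_mapping_eqI) (auto simp: lookup_sum lookup_single when_def sum.delta in_keys_iff)

text \<open>The product discards all monomials outside the basis, so the unit fixes exactly the
  elements of the carrier.\<close>

lemma dual_times_one_left:
  fixes f :: "'p::prime_card dual_elem"
  assumes "f \<in> carrier (dual_A n)"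
  shows "dual_times n (Poly_Mapping.single mono_one 1) f = f"
proof -
  have "dual_times n (Poly_Mapping.single mono_one 1) f =
      (\<Sum>m\<in>Poly_Mapping.keys f. Poly_Mapping.single m (Poly_Mapping.lookup f m))"
    unfolding dual_times_def using assms
    by (simp add: subset_iff tau_inversions_mono_one cong: sum.cong)
  then show ?thesis by (simp add: sum_single_lookup)
qed

lemma dual_times_one_right:
  fixes f :: "'p::prime_card dual_elem"
  assumes "f \<in> carrier (dual_A n)"
  shows "dual_times n f (Poly_Mapping.single mono_one 1) = f"
proof -
  have "dual_times n f (Poly_Mapping.single mono_one 1) =
      (\<Sum>m\<in>Poly_Mapping.keys f. Poly_Mapping.single m (Poly_Mapping.lookup f m))"
    unfolding dual_times_def using assms
    by (simp add: subset_iff tau_inversions_mono_one cong: sum.cong)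
  then show ?thesis by (simp add: sum_single_lookup)
qed

lemma dual_times_closed:
  fixes f g :: "'p::prime_card dual_elem"
  shows "dual_times n f g \<in> carrier (dual_A n)"
proof -
  have "Poly_Mapping.keys (dual_times n f g) \<subseteq> monomials CARD('p) n"
    unfolding dual_times_def
    by (rule order.trans[OF keys_sum] UN_least)+ (auto split: if_splits)
  then show ?thesis by simp
qed

lemma dual_pow_closed:
  "f [^]\<^bsub>dual_A n\<^esub> (k::nat) \<in> carrier (dual_A n :: 'p::prime_card dual_elem ring)"
proof (cases k)
  case 0
  then show ?thesis by (simp add: dual_pow_0 monomials_def mono_one_def)
qed (metis dual_pow_Suc dual_times_closed)

section \<open>The antipode on powers of a generator\<close>

lemma foldr_dual_times_ones:
  fixes y :: "'p::prime_card dual_elem"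
  assumes "\<And>z. z \<in> set zs \<Longrightarrow> z = \<one>\<^bsub>dual_A n\<^esub>" and "y \<in> carrier (dual_A n)"
  shows "foldr (\<lambda>f g. f \<otimes>\<^bsub>dual_A n\<^esub> g) zs y = y"
  using assms(1)
proof (induction zs)
  case (Cons a zs)
  then have "a = \<one>\<^bsub>dual_A n\<^esub>"
    by (meson list.set_intros(1))
  with Cons show ?case
    using dual_times_one_left[OF assms(2)] by simp
qed simp

text \<open>All factors except the one with index \<open>i\<close> are zeroth powers. The fold
  starts at the right: units above \<open>i\<close>, then the one essential factor, then units that
  preserve it.\<close>

lemma antipode_mono_xi_power:
  assumes "1 \<le> i" "i \<le> n"
  shows "antipode_mono n (xi_power i r) =
    (antipode_xi n i :: 'p::prime_card dual_elem) [^]\<^bsub>dual_A n\<^esub> r"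
proof -
  let ?x = "(antipode_xi n i :: 'p dual_elem) [^]\<^bsub>dual_A n\<^esub> r"
  let ?h = "\<lambda>k. (antipode_xi n k :: 'p dual_elem) [^]\<^bsub>dual_A n\<^esub> xi_exp (xi_power i r) k"
  have split: "[1..<n + 1] = [1..<i] @ i # [i + 1..<n + 1]"
    using assms by (metis Suc_eq_plus1 le_SucI le_add_diff_inverse less_Suc_eq_le upt_add_eq_append upt_conv_Cons)
  have one: "?h k = \<one>\<^bsub>dual_A n\<^esub>" if "k \<noteq> i" for k
    using that by (simp add: dual_pow_0)
  have unit: "\<one>\<^bsub>dual_A n\<^esub> \<in> carrier (dual_A n :: 'p dual_elem ring)"
    by (simp add: monomials_def mono_one_def)
  have x: "?x \<in> carrier (dual_A n)"
    by (rule dual_pow_closed)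
  have above: "foldr (\<lambda>f g. f \<otimes>\<^bsub>dual_A n\<^esub> g) (map ?h [i + 1..<n + 1]) \<one>\<^bsub>dual_A n\<^esub> = \<one>\<^bsub>dual_A n\<^esub>"
    by (rule foldr_dual_times_ones[OF _ unit]) (use one in auto)
  have "?h i \<otimes>\<^bsub>dual_A n\<^esub> \<one>\<^bsub>dual_A n\<^esub> = ?x"
    using dual_times_one_right[OF x] by simp
  moreover have "foldr (\<lambda>f g. f \<otimes>\<^bsub>dual_A n\<^esub> g) (map ?h [1..<i]) ?x = ?x"
    by (rule foldr_dual_times_ones[OF _ x]) (use one in auto)
  ultimately have "foldr (\<lambda>f g. f \<otimes>\<^bsub>dual_A n\<^esub> g) (map ?h [1..<n + 1]) \<one>\<^bsub>dual_A n\<^esub> = ?x"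
    unfolding split map_append foldr_append list.map foldr.simps o_apply above by simp
  then show ?thesis
    unfolding antipode_mono_def foldr_append
    by (simp only:) (rule foldr_dual_times_ones[OF _ x], auto simp: dual_pow_0)
qed

lemma antipode_single:
  "antipode n (Poly_Mapping.single m 1 :: 'p::prime_card dual_elem) =
    \<one>\<^bsub>dual_A n\<^esub> \<otimes>\<^bsub>dual_A n\<^esub> antipode_mono n m"
  by (simp add: antipode_def)

lemma single_mono_xi_pow:
  fixes c :: "'p::prime_card mod_ring"
  assumes "xi_power i k \<in> monomials CARD('p) n"
  shows "Poly_Mapping.single (mono_xi i) c [^]\<^bsub>dual_A n\<^esub> k = Poly_Mapping.single (xi_power i k) (c ^ k)"
  using assms
proof (induction k)
  case 0
  then show ?case by (simp add: dual_pow_0 xi_power_0)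
next
  case (Suc k)
  note p = two_le_prime_card[where 'p = 'p]
  from Suc.prems have "xi_power i k \<in> monomials CARD('p) n"
    by (auto simp: xi_power_in_monomials_iff[OF p])
  note IH = Suc.IH[OF this]
  have times: "mono_times (xi_power i k) (mono_xi i) = xi_power i (Suc k)"
    by (simp add: mono_times_eq_xi_power_iff flip: xi_power_1)
  show ?case
    \<comment> \<open>For \<open>c = 0\<close> the mapping has no keys, so the product vanishes;
      otherwise the double sum has one term.\<close>
    using Suc.prems by (cases "c = 0") (simp_all add: dual_pow_Suc IH dual_times_def times mult.commute)
qed

text \<open>From \<open>i + j \<le> n\<close> follows \<open>p^j < p^(n+1-i)\<close>, so
  \<open>\<xi>\<^sub>i^(p^j)\<close> is a basis monomial, and the linear extension that defines
  \<open>antipode\<close> is evaluated at this monomial alone.\<close>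

lemma antipode_xi_pow:
  fixes n :: nat
  assumes "1 \<le> i" "i + j \<le> n"
  shows "antipode n ((xi i :: 'p::prime_card dual_elem) [^]\<^bsub>dual_A n\<^esub> (CARD('p) ^ j)) =
    antipode_xi n i [^]\<^bsub>dual_A n\<^esub> (CARD('p) ^ j)"
proof -
  note p = two_le_prime_card[where 'p = 'p]
  have "xi_power i (CARD('p) ^ j) \<in> monomials CARD('p) n"
    using p assms by (simp add: xi_power_in_monomials_iff)
  then have "(xi i :: 'p dual_elem) [^]\<^bsub>dual_A n\<^esub> (CARD('p) ^ j) =
      Poly_Mapping.single (xi_power i (CARD('p) ^ j)) 1"
    unfolding xi_def by (subst single_mono_xi_pow) simp_all
  then show ?thesis
    using assms dual_times_one_left[OF dual_pow_closed]
    by (simp add: antipode_single antipode_mono_xi_power)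
qed

section \<open>Coefficients at the powers of a generator\<close>

text \<open>Only pairs of powers of the same generator multiply to \<open>xi_power i r\<close>, and
  they carry no sign as they contain no exterior generator. What remains is a Cauchy
  product.\<close>

lemma lookup_dual_times_xi_power:
  fixes f g :: "'p::prime_card dual_elem"
  assumes "xi_power i r \<in> monomials CARD('p) n"
  shows "Poly_Mapping.lookup (dual_times n f g) (xi_power i r) =
    (\<Sum>s\<le>r. Poly_Mapping.lookup f (xi_power i s) * Poly_Mapping.lookup g (xi_power i (r - s)))"
proof -
  let ?K = "Poly_Mapping.keys f \<times> Poly_Mapping.keys g"
  let ?T = "(\<lambda>s. (xi_power i s, xi_power i (r - s))) ` {..r}"
  let ?h = "\<lambda>(a, b). Poly_Mapping.lookup f a * Poly_Mapping.lookup g b"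
  have T: "(a, b) \<in> ?T \<longleftrightarrow> mono_times a b = xi_power i r" for a b
    by (auto simp: mono_times_eq_xi_power_iff)
  have "Poly_Mapping.lookup (dual_times n f g) (xi_power i r) =
      (\<Sum>a\<in>Poly_Mapping.keys f. \<Sum>b\<in>Poly_Mapping.keys g. if (a, b) \<in> ?T then ?h (a, b) else 0)"
    unfolding dual_times_def lookup_sum
  proof (intro sum.cong refl)
    fix a b
    show "Poly_Mapping.lookup (if mono_times a b \<in> monomials CARD('p) n
        then Poly_Mapping.single (mono_times a b)
          ((- 1) ^ tau_inversions a b * Poly_Mapping.lookup f a * Poly_Mapping.lookup g b)
        else 0) (xi_power i r) = (if (a, b) \<in> ?T then ?h (a, b) else 0)"
    proof (cases "(a, b) \<in> ?T")
      case True
      moreover from True obtain s where "a = xi_power i s" by auto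
      moreover from True have "mono_times a b = xi_power i r" by (simp only: T)
      ultimately show ?thesis using assms by simp
    next
      case False
      with T have "mono_times a b \<noteq> xi_power i r" by blast
      with False show ?thesis by (simp only: if_False) (auto simp: lookup_single_not_eq)
    qed
  qed
  also have "\<dots> = (\<Sum>ab\<in>?K. if ab \<in> ?T then ?h ab else 0)"
    by (simp only: sum.cartesian_product) (rule sum.cong, auto)
  also have "\<dots> = (\<Sum>ab\<in>?K \<inter> ?T. ?h ab)"
    by (simp add: sum.inter_restrict)
  \<comment> \<open>Pairs in \<open>?T\<close> that are not pairs of keys contribute a zero
    coefficient.\<close>
  also have "\<dots> = (\<Sum>ab\<in>?T. ?h ab)"
    by (intro sum.mono_neutral_left) (auto simp: in_keys_iff)
  also have "\<dots> = (\<Sum>s\<le>r. ?h (xi_power i s, xi_power i (r - s)))"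
    by (subst sum.reindex) (auto simp: inj_on_def)
  finally show ?thesis by simp
qed

text \<open>Up to truncation this is the ring map that sends all generators other than
  \<open>\<xi>\<^sub>i\<close> to 0 and \<open>\<xi>\<^sub>i\<close> to the variable. Power series
  allow computing with ordinary ring laws instead of those of the quotient.\<close>

definition xi_series :: "nat \<Rightarrow> 'p::prime_card dual_elem \<Rightarrow> 'p mod_ring fps" where
  "xi_series i f = Abs_fps (\<lambda>r. Poly_Mapping.lookup f (xi_power i r))"

lemma fps_nth_xi_series [simp]: "fps_nth (xi_series i f) r = Poly_Mapping.lookup f (xi_power i r)"
  by (simp add: xi_series_def)

lemma xi_series_diff [simp]: "xi_series i (f - g) = xi_series i f - xi_series i g"
  by (rule fps_ext) (simp add: lookup_minus)

lemma xi_series_uminus [simp]: "xi_series i (- f) = - xi_series i f"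
  by (rule fps_ext) simp

lemma xi_series_sum: "xi_series i (sum f A) = (\<Sum>a\<in>A. xi_series i (f a))"
  by (rule fps_ext) (simp add: lookup_sum fps_sum_nth)

lemma xi_series_one: "xi_series i (Poly_Mapping.single mono_one 1) = 1"
  by (rule fps_ext) (auto simp: lookup_single when_def simp flip: xi_power_0[of i])

lemma xi_series_xi: "xi_series i (xi k) = (if k = i then fps_X else 0)"
proof (rule fps_ext)
  fix r
  have "mono_xi k = xi_power i r \<longleftrightarrow> k = i \<and> r = 1"
    by (auto simp: mono_xi_def xi_power_def fun_eq_iff)
  then show "fps_nth (xi_series i (xi k)) r = fps_nth (if k = i then fps_X else 0) r"
    by (auto simp: xi_def lookup_single when_def)
qed

text \<open>Multiplication in the quotient only determines the coefficients below \<open>p^(n+1-i)\<close>, hence the cutoffs.\<close>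

lemma fps_cutoff_mult_cong:
  fixes a b c d :: "'a::semiring_1 fps"
  assumes "fps_cutoff N a = fps_cutoff N c" "fps_cutoff N b = fps_cutoff N d"
  shows "fps_cutoff N (a * b) = fps_cutoff N (c * d)"
proof (rule fps_ext)
  fix r
  have eq: "fps_nth a s = fps_nth c s" "fps_nth b s = fps_nth d s" if "s < N" for s
    using that assms[THEN arg_cong[of _ _ "\<lambda>f. fps_nth f s"]] by simp_all
  show "fps_nth (fps_cutoff N (a * b)) r = fps_nth (fps_cutoff N (c * d)) r"
    by (auto simp: fps_mult_nth eq intro!: sum.cong)
qed

lemma fps_cutoff_xi_series_times:
  fixes f g :: "'p::prime_card dual_elem"
  assumes "1 \<le> i" "i \<le> n" "N = CARD('p) ^ (n + 1 - i)"
  shows "fps_cutoff N (xi_series i (dual_times n f g)) = fps_cutoff N (xi_series i f * xi_series i g)"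
proof (rule fps_ext)
  fix r
  have "xi_power i r \<in> monomials CARD('p) n" if "r < N"
    using that assms two_le_prime_card[where 'p = 'p] by (simp add: xi_power_in_monomials_iff)
  then show "fps_nth (fps_cutoff N (xi_series i (dual_times n f g))) r =
      fps_nth (fps_cutoff N (xi_series i f * xi_series i g)) r"
    by (simp add: lookup_dual_times_xi_power fps_mult_nth atLeast0AtMost)
qed

lemma fps_cutoff_xi_series_pow:
  fixes f :: "'p::prime_card dual_elem"
  assumes "1 \<le> i" "i \<le> n" "N = CARD('p) ^ (n + 1 - i)"
  shows "fps_cutoff N (xi_series i (f [^]\<^bsub>dual_A n\<^esub> (k::nat))) = fps_cutoff N (xi_series i f ^ k)"
proof (induction k)
  case 0
  then show ?case by (simp add: dual_pow_0 xi_series_one)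
next
  case (Suc k)
  have "fps_cutoff N (xi_series i (f [^]\<^bsub>dual_A n\<^esub> Suc k)) =
      fps_cutoff N (xi_series i (f [^]\<^bsub>dual_A n\<^esub> k) * xi_series i f)"
    unfolding dual_pow_Suc by (rule fps_cutoff_xi_series_times[OF assms])
  also have "\<dots> = fps_cutoff N (xi_series i f ^ k * xi_series i f)"
    by (rule fps_cutoff_mult_cong[OF Suc refl])
  finally show ?case by (simp add: mult.commute)
qed

section \<open>The antipode at the powers of \<open>\<xi>\<^sub>1\<close>\<close>

text \<open>Only the summand \<open>k = m - 1\<close> contains \<open>\<xi>\<^sub>1\<close>. It
  multiplies the previous value by \<open>fps_X ^ (p^(m-1))\<close>, which extends the geometric sum
  in the exponent by one term, and the minus sign of the recursion flips the sign.\<close>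

lemma xi_series_antipode_xi:
  fixes n m :: nat
  assumes "N = CARD('p::prime_card) ^ n" "1 \<le> m" "m \<le> n"
  shows "fps_cutoff N (xi_series 1 (antipode_xi n m :: 'p dual_elem)) =
    fps_cutoff N ((- 1) ^ m * fps_X ^ (\<Sum>k = 0..<m. CARD('p) ^ k))"
  using assms(2,3)
proof (induction m rule: less_induct)
  case (less m)
  let ?p = "CARD('p)"
  let ?c = "\<lambda>k. antipode_xi n k :: 'p dual_elem"
  let ?e = "\<lambda>m. \<Sum>k = 0..<m. ?p ^ k"
  note p = two_le_prime_card[where 'p = 'p]
  \<comment> \<open>The relation on \<open>\<xi>\<^sub>1\<close> is
    \<open>\<xi>\<^sub>1^(p^n) = 0\<close>, which fixes the cutoff.\<close>
  have n: "1 \<le> (1::nat)" "1 \<le> n" "N = ?p ^ (n + 1 - 1)"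
    using assms less.prems by auto
  have summand: "fps_cutoff N (xi_series 1 (dual_times n (xi (m - k) [^]\<^bsub>dual_A n\<^esub> (?p ^ k)) (?c k))) =
      (if k = m - 1 then fps_cutoff N ((- 1) ^ k * fps_X ^ ?e m) else 0)"
    if "k \<in> {1..<m}" for k
  proof -
    have "fps_cutoff N (xi_series 1 (dual_times n (xi (m - k) [^]\<^bsub>dual_A n\<^esub> (?p ^ k)) (?c k))) =
        fps_cutoff N (xi_series 1 (xi (m - k) [^]\<^bsub>dual_A n\<^esub> (?p ^ k)) * xi_series 1 (?c k))"
      by (rule fps_cutoff_xi_series_times[OF n])
    also have "\<dots> = fps_cutoff N (xi_series 1 (xi (m - k)) ^ (?p ^ k) * ((- 1) ^ k * fps_X ^ ?e k))"
      using that less.prems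
      by (intro fps_cutoff_mult_cong fps_cutoff_xi_series_pow[OF n] less.IH) auto
    also have "\<dots> = (if k = m - 1 then fps_cutoff N ((- 1) ^ k * fps_X ^ ?e m) else 0)"
    proof (cases "k = m - 1")
      case True
      with that have "m = Suc k" by auto
      then show ?thesis
        by (simp add: xi_series_xi power_add mult_ac)
    next
      case False
      with that have "m - k \<noteq> 1" by auto
      with False p show ?thesis by (simp add: xi_series_xi power_0_left)
    qed
    finally show ?thesis .
  qed
  have cutoff_sum: "fps_cutoff N (sum f A) = (\<Sum>a\<in>A. fps_cutoff N (f a))"
    for f :: "nat \<Rightarrow> 'p mod_ring fps" and A
    by (rule fps_ext) (simp add: fps_sum_nth)
  have cutoff_diff: "fps_cutoff N (f - g) = fps_cutoff N f - fps_cutoff N g"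
    for f g :: "'p mod_ring fps"
    by (rule fps_ext) simp
  have "fps_cutoff N (xi_series 1 (?c m)) = fps_cutoff N (- (if m = 1 then fps_X else 0)) -
      (\<Sum>k\<in>{1..<m}. fps_cutoff N (xi_series 1 (dual_times n (xi (m - k) [^]\<^bsub>dual_A n\<^esub> (?p ^ k)) (?c k))))"
    by (simp only: antipode_xi.simps[of n m] dual_A_simps xi_series_diff xi_series_uminus
        xi_series_sum xi_series_xi cutoff_diff cutoff_sum)
  also have "\<dots> = fps_cutoff N (- (if m = 1 then fps_X else 0)) -
      (\<Sum>k\<in>{1..<m}. if k = m - 1 then fps_cutoff N ((- 1) ^ k * fps_X ^ ?e m) else 0)"
    by (rule arg_cong[OF sum.cong[OF refl summand]])
  also have "\<dots> = fps_cutoff N ((- 1) ^ m * fps_X ^ ?e m)"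
  \<comment> \<open>For \<open>m = 1\<close> the sum is empty and the leading term gives the value;
    for larger \<open>m\<close> the leading term vanishes and the sum has one nonzero index.\<close>
  proof (cases "m = 1")
    case False
    with less.prems obtain k where "m = Suc k" "1 \<le> k"
      by (cases m) auto
    then show ?thesis
      by (auto intro!: fps_ext)
  qed simp
  finally show ?case .
qed

text \<open>The power \<open>p^j\<close> shifts the exponents \<open>0..<i\<close> of the geometric
  sum to \<open>j..<i + j\<close>. The result stays below \<open>p^n\<close>, so the monomial
  survives truncation with coefficient 1 or -1.\<close>

lemma lookup_antipode_xi_pow:
  fixes n :: nat
  assumes "1 \<le> i" "i + j \<le> n"
  shows "Poly_Mapping.lookup ((antipode_xi n i :: 'p::prime_card dual_elem) [^]\<^bsub>dual_A n\<^esub> (CARD('p) ^ j))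
    (xi_power 1 (\<Sum>k = j..<i + j. CARD('p) ^ k)) \<noteq> 0"
proof -
  let ?p = "CARD('p)"
  let ?e = "\<Sum>k = 0..<i. ?p ^ k" and ?r = "\<Sum>k = j..<i + j. ?p ^ k"
  define N where "N = ?p ^ n"
  note p = two_le_prime_card[where 'p = 'p]
  have n: "1 \<le> (1::nat)" "1 \<le> n" "N = ?p ^ (n + 1 - 1)"
    using assms by (auto simp: N_def)
  have r: "?r = ?e * ?p ^ j"
    using sum.shift_bounds_nat_ivl[of "\<lambda>k. ?p ^ k" 0 j i]
    by (simp add: power_add sum_distrib_right)
  have "(\<Sum>k = 0..<m. ?p ^ k) < ?p ^ m" for m
  proof (induction m)
    case (Suc m)
    then have "(\<Sum>k = 0..<Suc m. ?p ^ k) < 2 * ?p ^ m" by simp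
    also have "\<dots> \<le> ?p ^ Suc m" using p by simp
    finally show ?case .
  qed simp
  then have "?r < ?p ^ (i + j)"
    using p by (simp add: r power_add)
  also have "\<dots> \<le> N"
    using assms p unfolding N_def by (intro power_increasing) auto
  finally have r_less: "?r < N" .
  have cutoff_pow: "fps_cutoff N (f ^ k) = fps_cutoff N (g ^ k)"
    if "fps_cutoff N f = fps_cutoff N g" for f g :: "'p mod_ring fps" and k
    by (induction k) (use that in \<open>auto intro: fps_cutoff_mult_cong\<close>)
  have "fps_cutoff N (xi_series 1 ((antipode_xi n i :: 'p dual_elem) [^]\<^bsub>dual_A n\<^esub> (?p ^ j))) =
      fps_cutoff N (xi_series 1 (antipode_xi n i :: 'p dual_elem) ^ (?p ^ j))"
    by (rule fps_cutoff_xi_series_pow[OF n])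
  also have "\<dots> = fps_cutoff N (((- 1) ^ i * fps_X ^ ?e) ^ (?p ^ j))"
    using assms by (intro cutoff_pow xi_series_antipode_xi) (auto simp: N_def)
  \<comment> \<open>Collecting the sign in a constant series lets the coefficient at
    \<open>?r\<close> be read off.\<close>
  also have "((- 1) ^ i * fps_X ^ ?e) ^ (?p ^ j) = fps_const ((- 1) ^ (i * ?p ^ j)) * (fps_X ^ ?r :: 'p mod_ring fps)"
    by (simp add: power_mult_distrib r flip: power_mult fps_const_power fps_const_neg)
  finally have "fps_nth (fps_cutoff N (xi_series 1 ((antipode_xi n i :: 'p dual_elem) [^]\<^bsub>dual_A n\<^esub> (?p ^ j)))) ?r =
      fps_nth (fps_cutoff N (fps_const ((- 1) ^ (i * ?p ^ j)) * fps_X ^ ?r)) ?r"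
    by (rule arg_cong)
  with r_less show ?thesis
    by (simp add: fps_X_power_iff)
qed

text \<open>For index 1 the sum in the recursion is empty, so the antipode of
  \<open>\<xi>\<^sub>1\<close> is \<open>- \<xi>\<^sub>1\<close>, whose powers involve one monomial.
  Hence a divisibility condition with \<open>i = 1\<close> leaves no choice of summand.\<close>

lemma keys_antipode_xi_1_pow:
  fixes n :: nat
  assumes "j < n"
  shows "Poly_Mapping.keys ((antipode_xi n 1 :: 'p::prime_card dual_elem) [^]\<^bsub>dual_A n\<^esub> (CARD('p) ^ j))
    \<subseteq> {xi_power 1 (CARD('p) ^ j)}"
proof -
  note p = two_le_prime_card[where 'p = 'p]
  have "(antipode_xi n 1 :: 'p dual_elem) = Poly_Mapping.single (mono_xi 1) (- 1)"
    by (subst antipode_xi.simps) (simp add: xi_def single_uminus)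
  moreover have "xi_power 1 (CARD('p) ^ j) \<in> monomials CARD('p) n"
    using p assms by (simp add: xi_power_in_monomials_iff)
  ultimately show ?thesis
    by (simp add: single_mono_xi_pow)
qed

section \<open>Equivalence of unilaterality and the divisibility conditions\<close>

theorem corollary3p23:
  fixes p n :: nat and x :: monomial
  assumes "p = CARD('p::prime_card)" and "odd p"
    and "x \<in> monomials p n"
  shows "unilateral (orient_to_larger (graph_of p n x)) \<longleftrightarrow>
    (\<forall>i j. 1 \<le> i \<and> i + j \<le> n \<longrightarrow>
      (\<exists>s \<in> summands (antipode n ((xi i :: 'p dual_elem) [^]\<^bsub>dual_A n\<^esub> (p ^ j))).
         is_factor p s x)) \<and>
    is_factor p (mono_tau 0) x"
proof -
  have p: "2 \<le> p"
    unfolding assms(1) by (rule two_le_prime_card)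
  \<comment> \<open>Exterior exponents are at most 1, so divisibility by
    \<open>\<tau>\<^sub>0\<close> becomes an equation.\<close>
  have "tau_exp x 0 \<le> 1"
    using assms(3) by (auto simp: monomials_def)
  then have tau: "is_factor p (mono_tau 0) x \<longleftrightarrow> tau_exp x 0 = 1"
    by (auto simp: is_factor_def mono_tau_def base_digit_def)
  have summands_eq: "summands (antipode n ((xi i :: 'p dual_elem) [^]\<^bsub>dual_A n\<^esub> (p ^ j))) =
      Poly_Mapping.keys ((antipode_xi n i :: 'p dual_elem) [^]\<^bsub>dual_A n\<^esub> (p ^ j))"
    if "1 \<le> i" "i + j \<le> n" for i j
    using that by (simp add: summands_def antipode_xi_pow assms(1))
  have "(\<forall>i j. 1 \<le> i \<and> i + j \<le> n \<longrightarrow>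
      (\<exists>s \<in> summands (antipode n ((xi i :: 'p dual_elem) [^]\<^bsub>dual_A n\<^esub> (p ^ j))). is_factor p s x))
    \<longleftrightarrow> (\<forall>j<n. 1 \<le> base_digit p (xi_exp x 1) j)" (is "?L \<longleftrightarrow> ?R")
  proof
    assume L: ?L
    show ?R
    proof (intro allI impI)
      fix j assume "j < n"
      with L obtain s
        where "s \<in> summands (antipode n ((xi 1 :: 'p dual_elem) [^]\<^bsub>dual_A n\<^esub> (p ^ j)))"
          and s: "is_factor p s x"
        by (metis Suc_leI le_refl plus_1_eq_Suc)
      with \<open>j < n\<close> have "s = xi_power 1 (p ^ j)"
        using keys_antipode_xi_1_pow[where 'p = 'p and n = n and j = j] summands_eq[of 1 j]
        by (auto simp: assms(1))
      with s have "base_digit p (p ^ j) j \<le> base_digit p (xi_exp x 1) j"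
        unfolding is_factor_def by (metis xi_exp_xi_power)
      with p show "1 \<le> base_digit p (xi_exp x 1) j"
        by (simp add: base_digit_power)
    qed
  next
    assume R: ?R
    show ?L
    proof (intro allI impI)
      fix i j assume ij: "1 \<le> i \<and> i + j \<le> n"
      \<comment> \<open>This summand is the product of the \<open>\<xi>\<^sub>1^(p^k)\<close> with
        \<open>j \<le> k < i + j\<close>: its digits are 1 at these positions and 0 elsewhere. As
        \<open>i + j \<le> n\<close>, each such \<open>k\<close> is below \<open>n\<close> and
        covered by \<open>R\<close>.\<close>
      let ?s = "xi_power 1 (\<Sum>k = j..<i + j. p ^ k)"
      have "?s \<in> summands (antipode n ((xi i :: 'p dual_elem) [^]\<^bsub>dual_A n\<^esub> (p ^ j)))"
        using ij lookup_antipode_xi_pow[where 'p = 'p and n = n and i = i and j = j] summands_eq[of i j]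
        by (simp add: in_keys_iff assms(1))
      moreover have "is_factor p ?s x"
        using R ij p by (auto simp: is_factor_def base_digit_sum_powers) (simp add: base_digit_def)
      ultimately show "\<exists>s \<in> summands (antipode n ((xi i :: 'p dual_elem) [^]\<^bsub>dual_A n\<^esub> (p ^ j))).
          is_factor p s x"
        by blast
    qed
  qed
  then show ?thesis
    unfolding tau using unilateral_graph_of_iff[OF p, of n x] by blast
qed

end
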